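(* There exist finitely generated groups $G$ and $H$ which are not isomorphic but have the same two-sided configuration sets, i.e. $\operatorname{Con}_{\mathrm t}(G)=\operatorname{Con}_{\mathrm t}(H)$.
   Context: A configuration pair $(\mathfrak g,\mathcal E)$ of a finitely generated (discrete) group $G$ consists of an ordered generating set, i.e. a finite tuple $\mathfrak g=(g_1,\dots,g_n)$ of elements of $G$ whose entries generate $G$ as a group, and a finite partition $\mathcal E=\{E_1,\dots,E_m\}$ of $G$ with indexed blocks. A two-sided configuration corresponding to $(\mathfrak g,\mathcal E)$ is a $(2n+1)$-tuple $C=(c_0,c_1,\dots,c_{2n})$ with $c_i\in\{1,\dots,m\}$ for which there exists $x\in E_{c_0}$ such that $g_ix\in E_{c_i}$ and $xg_i\in E_{c_{i+n}}$ for each $i\in\{1,\dots,n\}$. The set of all of these is denoted $\operatorname{Con}_{\mathrm t}(\mathfrak g,\mathcal E)$. $\operatorname{Con}_{\mathrm t}(G)$ is the set of all sets $\operatorname{Con}_{\mathrm t}(\mathfrak g,\mathcal E)$, where $(\mathfrak g,\mathcal E)$ ranges over all configuration pairs of $G$. *)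

theory Defs
  imports "HOL-Algebra.Generated_Groups" "HOL-Library.Disjoint_Sets"
begin

definition ordered_generating_set :: "('a, 'b) monoid_scheme \<Rightarrow> 'a list \<Rightarrow> bool" where
  "ordered_generating_set G gs \<longleftrightarrow>
     set gs \<subseteq> carrier G \<and> generate G (set gs) = carrier G"

text \<open>
  Every finitely generated group is countable, hence isomorphic to a group whose carrier is a set
  of natural numbers. An existence statement about finitely generated groups may therefore
  quantify over \<^typ>\<open>nat monoid\<close> without loss of generality.
\<close>

definition finitely_generated_group :: "('a, 'b) monoid_scheme \<Rightarrow> bool" where
  "finitely_generated_group G \<longleftrightarrow> group G \<and>
     (\<exists>S. finite S \<and> S \<subseteq> carrier G \<and> generate G S = carrier G)"

text \<open>
  A partition with indexed blocks \<open>E\<^sub>1, \<dots>, E\<^sub>m\<close> is the list of its blocks; distinctness of the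
  list makes the indexing injective, and \<^const>\<open>partition_on\<close> forces the blocks to be nonempty.
\<close>

definition indexed_partition :: "'a set \<Rightarrow> 'a set list \<Rightarrow> bool" where
  "indexed_partition A Es \<longleftrightarrow> distinct Es \<and> partition_on A (set Es)"

definition configuration_pair ::
    "('a, 'b) monoid_scheme \<Rightarrow> 'a list \<Rightarrow> 'a set list \<Rightarrow> bool" where
  "configuration_pair G gs Es \<longleftrightarrow>
     ordered_generating_set G gs \<and> indexed_partition (carrier G) Es"

text \<open>
  Generators and blocks are numbered from 1, whereas list positions start at 0, so \<open>g\<^sub>i\<close> is
  \<open>gs ! (i - 1)\<close> and \<open>E\<^sub>k\<close> is \<open>Es ! (k - 1)\<close>. The entries \<open>c\<^sub>0, \<dots>, c\<^bsub>2n\<^esub>\<close> of a configuration are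
  \<open>c ! 0, \<dots>, c ! (2n)\<close>, without shift.
\<close>

definition two_sided_configuration ::
    "('a, 'b) monoid_scheme \<Rightarrow> 'a list \<Rightarrow> 'a set list \<Rightarrow> nat list \<Rightarrow> bool" where
  "two_sided_configuration G gs Es c \<longleftrightarrow>
     (let n = length gs; m = length Es in
        length c = 2 * n + 1 \<and>
        (\<forall>i\<in>{0..2 * n}. c ! i \<in> {1..m}) \<and>
        (\<exists>x\<in>Es ! (c ! 0 - 1). \<forall>i\<in>{1..n}.
           gs ! (i - 1) \<otimes>\<^bsub>G\<^esub> x \<in> Es ! (c ! i - 1) \<and>
           x \<otimes>\<^bsub>G\<^esub> gs ! (i - 1) \<in> Es ! (c ! (i + n) - 1)))"

definition Con_t_pair ::
    "('a, 'b) monoid_scheme \<Rightarrow> 'a list \<Rightarrow> 'a set list \<Rightarrow> nat list set" where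
  "Con_t_pair G gs Es = {c. two_sided_configuration G gs Es c}"

definition Con_t :: "('a, 'b) monoid_scheme \<Rightarrow> nat list set set" where
  "Con_t G = {Con_t_pair G gs Es | gs Es. configuration_pair G gs Es}"

end

(*
  The proof rests on a lifting principle. Let f be an epimorphism from G onto H whose kernel consists
  of central commutators. If M is the subgroup generated by arbitrary lifts of a generating tuple of
  H, then G = M ker f, so every commutator of G is a commutator of M; hence ker f lies in M and
  M = G. Since pulling back a partition along f does not change the configurations, every
  two-sided configuration set of H is one of G.

  It remains to find two non-isomorphic groups that map onto each other in this way. Let
  R = Z[t, 1/t] and let Gamma be P. Hall's group of matrices ((1, x, z), (0, t^k, y), (0, 0, 1))
  over R. Each additive subgroup W of R gives a central subgroup of Gamma by means of the entry z; let
  Gamma_W be the quotient. Take for W the Laurent polynomials in t R_+ and for W' those in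
  2 Z + t R_+, where R_+ = Z[t]. As W is contained in W', Gamma_W' is a quotient of Gamma_W; as
  t W' is contained in W, conjugation by diag(t, 1, 1) induces an epimorphism from Gamma_W'
  onto Gamma_W. But Gamma_W has no element of order 2, while Gamma_W' has one, given by z = 1.
*)

theory Submission
  imports Defs "HOL-Algebra.Weak_Morphisms" "HOL-Library.Poly_Mapping" "HOL-Library.Countable_Set"
begin

section \<open>Lifting configurations along central extensions\<close>

text \<open>The hypothesis \<open>commutator\<close> is the inverse-free form of k = a b a^-1 b^-1.
  Such a commutator is unchanged when a and b are multiplied by central elements, so a and b may be
  replaced by elements of the subgroup generated by S.\<close>

lemma (in group_hom) lift_generators:
  assumes surj: "h ` carrier G = carrier H"
    and central: "\<And>k g. k \<in> kernel G H h \<Longrightarrow> g \<in> carrier G \<Longrightarrow> k \<otimes> g = g \<otimes> k"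
    and commutator: "\<And>k. k \<in> kernel G H h \<Longrightarrow>
      \<exists>a\<in>carrier G. \<exists>b\<in>carrier G. k \<otimes> (b \<otimes> a) = a \<otimes> b"
    and S: "S \<subseteq> carrier G" and gen: "generate H (h ` S) = carrier H"
  shows "generate G S = carrier G"
proof -
  define M where "M = generate G S"
  have sub: "subgroup M G"
    unfolding M_def using S by (rule G.generate_is_subgroup)
  have M_carrier: "m \<in> carrier G" if "m \<in> M" for m
    using sub that by (rule subgroup.mem_carrier)
  have img: "h ` M = carrier H"
    unfolding M_def using generate_img[OF S] gen by simp
  have decomp: "\<exists>m\<in>M. \<exists>k\<in>kernel G H h. g = m \<otimes> k" if g: "g \<in> carrier G" for g
  proof -
    from g have "h g \<in> h ` M" using img by simp
    then obtain m where m: "m \<in> M" "h g = h m" by auto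
    have mc: "m \<in> carrier G" using m(1) by (rule M_carrier)
    have "inv m \<otimes> g \<in> kernel G H h"
      using g mc m(2) by (simp add: kernel_def)
    moreover have "g = m \<otimes> (inv m \<otimes> g)"
      using g mc by (simp add: G.m_assoc[symmetric])
    ultimately show ?thesis using m(1) by blast
  qed
  have kernel_carrier: "k \<in> carrier G" if "k \<in> kernel G H h" for k
    using that by (simp add: kernel_def)
  have ker: "k \<in> M" if k: "k \<in> kernel G H h" for k
  proof -
    obtain a b where ab: "a \<in> carrier G" "b \<in> carrier G" "k \<otimes> (b \<otimes> a) = a \<otimes> b"
      using commutator[OF k] by blast
    \<comment> \<open>Write a and b as elements of M times central kernel elements u and v. Both a b
      and b a then carry the same factor u v, which cancels from the commutator equation.\<close>
    obtain m u where m: "m \<in> M" "u \<in> kernel G H h" "a = m \<otimes> u" using decomp[OF ab(1)] by blast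
    obtain n v where n: "n \<in> M" "v \<in> kernel G H h" "b = n \<otimes> v" using decomp[OF ab(2)] by blast
    note [simp] = M_carrier[OF m(1)] M_carrier[OF n(1)]
      kernel_carrier[OF m(2)] kernel_carrier[OF n(2)] kernel_carrier[OF k]
    have "a \<otimes> b = m \<otimes> (u \<otimes> n) \<otimes> v"
      by (simp add: m(3) n(3) G.m_assoc)
    also have "\<dots> = (m \<otimes> n) \<otimes> (u \<otimes> v)"
      by (simp add: central[OF m(2)] G.m_assoc)
    finally have ab': "a \<otimes> b = (m \<otimes> n) \<otimes> (u \<otimes> v)" .
    have "b \<otimes> a = n \<otimes> (v \<otimes> m) \<otimes> u"
      by (simp add: m(3) n(3) G.m_assoc)
    also have "\<dots> = (n \<otimes> m) \<otimes> (v \<otimes> u)"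
      by (simp add: central[OF n(2)] G.m_assoc)
    also have "v \<otimes> u = u \<otimes> v"
      by (simp add: central[OF n(2)])
    finally have ba': "b \<otimes> a = (n \<otimes> m) \<otimes> (u \<otimes> v)" .
    have "(k \<otimes> (n \<otimes> m)) \<otimes> (u \<otimes> v) = (m \<otimes> n) \<otimes> (u \<otimes> v)"
      using ab(3) unfolding ab' ba' by (simp add: G.m_assoc)
    then have "k \<otimes> (n \<otimes> m) = m \<otimes> n"
      by (simp add: G.right_cancel)
    then have "k = (m \<otimes> n) \<otimes> inv (n \<otimes> m)"
      by (simp add: G.inv_solve_right)
    then show ?thesis
      using m(1) n(1) sub by (simp add: subgroup.m_closed subgroup.m_inv_closed)
  qed
  have "carrier G \<subseteq> M"
    using decomp ker subgroup.m_closed[OF sub] by blast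
  then show ?thesis
    using subgroup.subset[OF sub] unfolding M_def by blast
qed

text \<open>By surjectivity a block is recovered as the image of its preimage. Hence distinct blocks
  have distinct preimages, which keeps the list distinct, and no preimage is empty.\<close>

lemma indexed_partition_vimage:
  assumes "indexed_partition B Es" and surj: "f ` A = B"
  shows "indexed_partition A (map (\<lambda>E. {x \<in> A. f x \<in> E}) Es)"
proof -
  let ?p = "\<lambda>E. {x \<in> A. f x \<in> E}"
  have part: "partition_on B (set Es)" and dist: "distinct Es"
    using assms(1) by (auto simp: indexed_partition_def)
  have img: "f ` ?p E = E" if "E \<in> set Es" for E
  proof -
    have "E \<subseteq> f ` A" unfolding surj partition_onD1[OF part] using that by (rule Union_upper)
    then show ?thesis by auto
  qed
  then have "inj_on ?p (set Es)"
    by (metis (no_types, lifting) inj_onI)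
  moreover have "partition_on A (?p ` set Es)"
  proof (rule partition_onI)
    show "\<Union> (?p ` set Es) = A"
      using partition_onD1[OF part] surj by auto
    show "disjnt p q" if "p \<in> ?p ` set Es" "q \<in> ?p ` set Es" "p \<noteq> q" for p q
    proof -
      obtain E F where EF: "E \<in> set Es" "F \<in> set Es" "p = ?p E" "q = ?p F"
        using \<open>p \<in> _\<close> \<open>q \<in> _\<close> by blast
      then have "E \<inter> F = {}"
        using \<open>p \<noteq> q\<close> by (intro disjointD[OF partition_onD2[OF part]]) auto
      then show ?thesis unfolding EF disjnt_def by blast
    qed
    show "{} \<notin> ?p ` set Es"
    proof
      assume "{} \<in> ?p ` set Es"
      then obtain E where "E \<in> set Es" "?p E = {}" by auto
      then have "{} \<in> set Es" using img[of E] by (simp only: image_empty)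
      then show False using partition_onD3[OF part] by blast
    qed
  qed
  ultimately show ?thesis
    using dist by (simp add: indexed_partition_def distinct_map)
qed

text \<open>If x witnesses a configuration of the pulled-back partition, then h x witnesses it
  below; conversely, each witness y below has the form h x by surjectivity, and any such x
  works.\<close>

lemma (in group_hom) Con_t_pair_vimage:
  assumes surj: "h ` carrier G = carrier H" and gs: "set gs \<subseteq> carrier G"
    and Es: "\<Union> (set Es) = carrier H"
  shows "Con_t_pair G gs (map (\<lambda>E. {x \<in> carrier G. h x \<in> E}) Es) = Con_t_pair H (map h gs) Es"
proof -
  have nth: "Es ! (c ! i - 1) \<subseteq> carrier H" "c ! i - 1 < length Es"
    if "\<forall>i\<in>{0..2 * length gs}. c ! i \<in> {1..length Es}" "i \<le> 2 * length gs" for c i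
  proof -
    show "c ! i - 1 < length Es" using that(1)[rule_format, of i] that(2) by auto
    then show "Es ! (c ! i - 1) \<subseteq> carrier H" using Es by (metis Sup_upper nth_mem)
  qed
  have gsc: "gs ! (i - 1) \<in> carrier G" "i - 1 < length gs" if "i \<in> {1..length gs}" for i
  proof -
    show "i - 1 < length gs" using that by auto
    then show "gs ! (i - 1) \<in> carrier G" using gs nth_mem by blast
  qed
  let ?Fs = "map (\<lambda>E. {x \<in> carrier G. h x \<in> E}) Es"
  have "two_sided_configuration G gs ?Fs c \<longleftrightarrow> two_sided_configuration H (map h gs) Es c" for c
  \<comment> \<open>The length and range conditions agree on both sides, so only tuples satisfying
    them matter. The range condition also keeps every index c ! i - 1 inside the list, where
    \<open>nth\<close> commutes with \<open>map\<close>.\<close>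
  proof (cases "length c = 2 * length gs + 1 \<and> (\<forall>i\<in>{0..2 * length gs}. c ! i \<in> {1..length Es})")
    case True
    then have r: "\<forall>i\<in>{0..2 * length gs}. c ! i \<in> {1..length Es}" by blast
    have F: "?Fs ! (c ! i - 1) = {x \<in> carrier G. h x \<in> Es ! (c ! i - 1)}"
      if "i \<le> 2 * length gs" for i
      using nth(2)[OF r that] by simp
    have step: "(gs ! (i - 1) \<otimes> x \<in> ?Fs ! (c ! i - 1) \<and> x \<otimes> gs ! (i - 1) \<in> ?Fs ! (c ! (i + length gs) - 1))
        \<longleftrightarrow> (map h gs ! (i - 1) \<otimes>\<^bsub>H\<^esub> h x \<in> Es ! (c ! i - 1) \<and>
            h x \<otimes>\<^bsub>H\<^esub> map h gs ! (i - 1) \<in> Es ! (c ! (i + length gs) - 1))"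
      if "x \<in> carrier G" "i \<in> {1..length gs}" for x i
    proof -
      have b: "i \<le> 2 * length gs" "i + length gs \<le> 2 * length gs" using that(2) by auto
      show ?thesis
        unfolding F[OF b(1)] F[OF b(2)] using that(1) gsc[OF that(2)] by simp
    qed
    let ?P = "\<lambda>x. \<forall>i\<in>{1..length gs}. gs ! (i - 1) \<otimes> x \<in> ?Fs ! (c ! i - 1) \<and>
      x \<otimes> gs ! (i - 1) \<in> ?Fs ! (c ! (i + length gs) - 1)"
    let ?Q = "\<lambda>y. \<forall>i\<in>{1..length gs}. map h gs ! (i - 1) \<otimes>\<^bsub>H\<^esub> y \<in> Es ! (c ! i - 1) \<and>
      y \<otimes>\<^bsub>H\<^esub> map h gs ! (i - 1) \<in> Es ! (c ! (i + length gs) - 1)"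
    have PQ: "?P x \<longleftrightarrow> ?Q (h x)" if "x \<in> carrier G" for x
      using step[OF that] by (rule ball_cong[OF refl])
    have "(\<exists>x\<in>?Fs ! (c ! 0 - 1). ?P x) \<longleftrightarrow> (\<exists>x\<in>?Fs ! (c ! 0 - 1). ?Q (h x))"
    proof (rule bex_cong[OF refl])
      fix x assume "x \<in> ?Fs ! (c ! 0 - 1)"
      then have "x \<in> carrier G" by (simp only: F[OF le0] mem_Collect_eq)
      then show "?P x \<longleftrightarrow> ?Q (h x)" by (rule PQ)
    qed
    also have "\<dots> \<longleftrightarrow> (\<exists>y\<in>h ` (?Fs ! (c ! 0 - 1)). ?Q y)"
      by (simp only: bex_simps)
    also have "h ` (?Fs ! (c ! 0 - 1)) = Es ! (c ! 0 - 1)"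
      unfolding F[OF le0] using nth(1)[OF r le0] surj by (auto simp del: One_nat_def)
    finally show ?thesis
      using True by (simp only: two_sided_configuration_def Let_def length_map simp_thms)
  next
    case False
    then show ?thesis by (simp only: two_sided_configuration_def Let_def length_map) blast
  qed
  then show ?thesis by (simp add: Con_t_pair_def)
qed

lemma (in group_hom) Con_t_subset:
  assumes surj: "h ` carrier G = carrier H"
    and central: "\<And>k g. k \<in> kernel G H h \<Longrightarrow> g \<in> carrier G \<Longrightarrow> k \<otimes> g = g \<otimes> k"
    and commutator: "\<And>k. k \<in> kernel G H h \<Longrightarrow>
      \<exists>a\<in>carrier G. \<exists>b\<in>carrier G. k \<otimes> (b \<otimes> a) = a \<otimes> b"
  shows "Con_t H \<subseteq> Con_t G"
proof
  fix C assume "C \<in> Con_t H"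
  then obtain hs Es where C: "C = Con_t_pair H hs Es"
    and hs: "set hs \<subseteq> carrier H" "generate H (set hs) = carrier H"
    and Es: "indexed_partition (carrier H) Es"
    by (auto simp: Con_t_def configuration_pair_def ordered_generating_set_def)
  \<comment> \<open>Any choice of preimages will do, because \<open>lift_generators\<close> applies
    to every lift.\<close>
  define gs where "gs = map (inv_into (carrier G) h) hs"
  have hs_gs: "map h gs = hs"
    using hs(1) surj by (auto simp: gs_def f_inv_into_f intro!: map_idI)
  have gs: "set gs \<subseteq> carrier G"
    using hs(1) surj by (auto simp: gs_def intro!: inv_into_into)
  have "h ` set gs = set hs"
    using hs_gs by (metis set_map)
  then have "generate G (set gs) = carrier G"
    using hs(2) by (intro lift_generators[OF surj central commutator gs]) auto
  then have "configuration_pair G gs (map (\<lambda>E. {x \<in> carrier G. h x \<in> E}) Es)"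
    using gs indexed_partition_vimage[OF Es surj]
    by (simp add: configuration_pair_def ordered_generating_set_def)
  moreover have "C = Con_t_pair G gs (map (\<lambda>E. {x \<in> carrier G. h x \<in> E}) Es)"
    using Con_t_pair_vimage[OF surj gs, of Es] Es C hs_gs
    by (simp add: indexed_partition_def partition_on_def)
  ultimately show "C \<in> Con_t G"
    unfolding Con_t_def by blast
qed

section \<open>Invariance under isomorphism and transport to carriers of natural numbers\<close>

lemma Con_t_subset_of_iso:
  assumes "group G" "group H" "h \<in> iso G H"
  shows "Con_t H \<subseteq> Con_t G"
proof -
  interpret group_hom G H h
    using assms by (simp add: group_hom_def group_hom_axioms_def iso_def)
  have inj: "inj_on h (carrier G)" and surj: "h ` carrier G = carrier H"
    using assms(3) by (auto simp: iso_def bij_betw_def)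
  \<comment> \<open>The kernel is trivial, and the unit is central and the commutator of the unit
    with itself, so an isomorphism is a degenerate case of \<open>Con_t_subset\<close>.\<close>
  have "k = \<one>\<^bsub>G\<^esub>" if "k \<in> kernel G H h" for k
    using that inj_onD[OF inj, of k "\<one>\<^bsub>G\<^esub>"] by (simp add: kernel_def)
  then show ?thesis
    using surj by (intro Con_t_subset) force+
qed

lemma Con_t_iso:
  assumes "group G" "group H" "G \<cong> H"
  shows "Con_t G = Con_t H"
proof -
  from assms(3) obtain h where "h \<in> iso G H" by (auto simp: is_iso_def)
  moreover obtain h' where "h' \<in> iso H G"
    using group.iso_sym[OF assms(1,3)] by (auto simp: is_iso_def)
  ultimately show ?thesis
    using Con_t_subset_of_iso[OF assms(1,2)] Con_t_subset_of_iso[OF assms(2,1)] by (metis subset_antisym)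
qed

lemma finitely_generated_group_iso:
  assumes "finitely_generated_group G" "group H" "G \<cong> H"
  shows "finitely_generated_group H"
proof -
  obtain S where S: "group G" "finite S" "S \<subseteq> carrier G" "generate G S = carrier G"
    using assms(1) by (auto simp: finitely_generated_group_def)
  obtain h where h: "h \<in> hom G H" "h ` carrier G = carrier H"
    using assms(3) by (auto simp: is_iso_def iso_def bij_betw_def)
  interpret group_hom G H h
    using S(1) assms(2) h(1) by (simp add: group_hom_def group_hom_axioms_def)
  have "generate H (h ` S) = carrier H"
    using generate_img[OF S(3)] S(4) h(2) by simp
  then show ?thesis
    unfolding finitely_generated_group_def using assms(2) S(2,3) h(2) by blast
qed

lemma countable_group_iso_nat:
  assumes "group G" "countable (carrier G)"
  obtains N :: "nat monoid" where "group N" "G \<cong> N"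
proof -
  obtain f :: "_ \<Rightarrow> nat" where f: "inj_on f (carrier G)"
    using assms(2) unfolding countable_def by blast
  have "f \<in> iso G (image_group f G)"
    using f group.is_monoid[OF assms(1)]
    by (auto simp: iso_def hom_def bij_betw_def image_group_def monoid.m_closed)
  \<comment> \<open>The library result concerns the target with its unit replaced by the image of
    the unit; for \<open>image_group\<close> this replacement changes nothing.\<close>
  moreover from this have "group (image_group f G)"
    using group.iso_imp_img_group[OF assms(1)] by (fastforce simp: image_group_def)
  ultimately show ?thesis
    using that by (auto simp: is_iso_def)
qed

section \<open>Central quotients of Hall's group\<close>

type_synonym laurent = "int \<Rightarrow>\<^sub>0 int"

text \<open>This is the monomial t^k: finitely supported functions from Z to Z multiply by
  convolution, so \<open>laurent\<close> is the ring Z[t, 1/t].\<close>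

abbreviation T :: "int \<Rightarrow> laurent" where
  "T k \<equiv> Poly_Mapping.single k 1"

lemma T_add: "T (j + k) = T j * T k"
  by (simp add: mult_single)

lemma T_cancel [simp]: "T (- k) * (T k * f) = f" "T k * (T (- k) * f) = f"
  by (simp_all add: mult.assoc[symmetric] mult_single)

lemma lookup_T_mult: "Poly_Mapping.lookup (T k * f) i = Poly_Mapping.lookup f (i - k)"
proof -
  have "Poly_Mapping.keys f \<subseteq> UNIV" by simp
  then show ?thesis
  proof (induction f rule: frag_induction)
    case (one x)
    then show ?case by (auto simp: mult_single lookup_single when_def)
  qed (simp_all add: right_diff_distrib lookup_minus)
qed

text \<open>The cases match what a subgroup of Hall's group offers: 1 is the entry of a generator,
  multiplication by t^k is a conjugation, and differences arise from products with inverses.\<close>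

lemma laurent_induct [case_names one T diff]:
  assumes "P 1" "\<And>f k. P f \<Longrightarrow> P (T k * f)" "\<And>f g. P f \<Longrightarrow> P g \<Longrightarrow> P (f - g)"
  shows "P (f :: laurent)"
proof -
  have "Poly_Mapping.keys f \<subseteq> UNIV" by simp
  then show ?thesis
  proof (induction f rule: frag_induction)
    case zero
    then show ?case using assms(3)[OF assms(1) assms(1)] by simp
  next
    case (one x)
    then show ?case using assms(2)[OF assms(1), of x] by simp
  next
    case (diff f g)
    then show ?case using assms(3) by blast
  qed
qed

text \<open>A Laurent polynomial is determined by the graph of its coefficients over its support,
  which is a finite set of pairs of integers.\<close>

lemma countable_laurent: "countable (UNIV :: laurent set)"
proof (rule countable_image_inj_on)
  let ?g = "\<lambda>f :: laurent. (\<lambda>k. (k, Poly_Mapping.lookup f k)) ` Poly_Mapping.keys f"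
  show "inj_on ?g UNIV"
  proof (rule injI, rule poly_mapping_eqI)
    fix f g :: laurent and k assume eq: "?g f = ?g g"
    show "Poly_Mapping.lookup f k = Poly_Mapping.lookup g k"
    proof (cases "k \<in> Poly_Mapping.keys f \<or> k \<in> Poly_Mapping.keys g")
      case True
      then have "(k, Poly_Mapping.lookup f k) \<in> ?g g \<or> (k, Poly_Mapping.lookup g k) \<in> ?g f"
        using eq by blast
      then show ?thesis by auto
    qed (simp add: in_keys_iff)
  qed
  have "countable {A :: (int \<times> int) set. finite A}"
    by (rule countable_Collect_finite)
  then show "countable (range ?g)"
    by (rule countable_subset[rotated]) auto
qed

section \<open>Additive subgroups and representatives of their cosets\<close>

definition add_subgroup :: "'a :: ab_group_add set \<Rightarrow> bool" where
  "add_subgroup W \<longleftrightarrow> 0 \<in> W \<and> (\<forall>a\<in>W. \<forall>b\<in>W. a - b \<in> W)"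

lemma add_subgroup_uminus:
  assumes "add_subgroup W" "a \<in> W"
  shows "- a \<in> W"
  using assms unfolding add_subgroup_def by (metis diff_0)

lemma add_subgroup_add:
  assumes "add_subgroup W" "a \<in> W" "b \<in> W"
  shows "a + b \<in> W"
  using add_subgroup_uminus[OF assms(1,3)] assms unfolding add_subgroup_def
  by (metis diff_minus_eq_add)

text \<open>For a subgroup W the predicate under \<open>SOME\<close> depends only on the coset of a.
  All elements of a coset therefore get the same representative, and equality modulo W becomes
  equality of values.\<close>

definition coset_rep :: "'a :: ab_group_add set \<Rightarrow> 'a \<Rightarrow> 'a" where
  "coset_rep W a = (SOME b. a - b \<in> W)"

text \<open>
  The quotient of the group of matrices \<open>((1, x, z), (0, t\<^sup>k, y), (0, 0, 1))\<close> by \<open>z \<in> W\<close>, in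
  normal form: the entry \<open>z\<close> is replaced by the chosen representative of its coset.
\<close>

definition hall_group :: "laurent set \<Rightarrow> (laurent \<times> int \<times> laurent \<times> laurent) monoid" where
  "hall_group W = \<lparr>
     carrier = UNIV \<times> UNIV \<times> UNIV \<times> range (coset_rep W),
     mult = (\<lambda>(x, k, y, z) (x', k', y', z').
       (x' + x * T k', k + k', T k * y' + y, coset_rep W (z + z' + x * y'))),
     one = (0, 0, 0, coset_rep W 0)\<rparr>"

section \<open>Group structure and finite generation of the quotients\<close>

locale laurent_subgroup =
  fixes W :: "laurent set"
  assumes add_subgroup: "add_subgroup W"
begin

lemma diff_coset_rep: "a - coset_rep W a \<in> W"
  unfolding coset_rep_def using add_subgroup
  by (intro someI[of "\<lambda>b. a - b \<in> W" a]) (simp add: add_subgroup_def)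

lemma coset_rep_eq_iff: "coset_rep W a = coset_rep W b \<longleftrightarrow> a - b \<in> W"
proof
  assume "coset_rep W a = coset_rep W b"
  then have "(a - coset_rep W a) - (b - coset_rep W b) = a - b" by simp
  then show "a - b \<in> W"
    using diff_coset_rep add_subgroup unfolding add_subgroup_def by metis
next
  assume ab: "a - b \<in> W"
  have "a - c \<in> W \<longleftrightarrow> b - c \<in> W" for c
  proof
    assume "a - c \<in> W"
    then have "(a - c) - (a - b) \<in> W" using ab add_subgroup unfolding add_subgroup_def by blast
    then show "b - c \<in> W" by simp
  next
    assume "b - c \<in> W"
    then have "(a - b) + (b - c) \<in> W" using ab add_subgroup_add[OF add_subgroup] by blast
    then show "a - c \<in> W" by simp
  qed
  then show "coset_rep W a = coset_rep W b" by (simp add: coset_rep_def)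
qed

lemma coset_rep_idem [simp]: "coset_rep W (coset_rep W a) = coset_rep W a"
  using diff_coset_rep coset_rep_eq_iff by metis

lemma coset_rep_add [simp]:
  "coset_rep W (coset_rep W a + b) = coset_rep W (a + b)"
  "coset_rep W (b + coset_rep W a) = coset_rep W (b + a)"
proof -
  have "coset_rep W a - a \<in> W" using coset_rep_eq_iff coset_rep_idem by metis
  then show "coset_rep W (coset_rep W a + b) = coset_rep W (a + b)"
    "coset_rep W (b + coset_rep W a) = coset_rep W (b + a)"
    by (simp_all add: coset_rep_eq_iff)
qed

text \<open>The class of a matrix whose entry z need not be normalised; with
  \<open>elt_mult\<close>, calculations in the quotient become calculations with matrices.\<close>

abbreviation elt :: "laurent \<Rightarrow> int \<Rightarrow> laurent \<Rightarrow> laurent \<Rightarrow> laurent \<times> int \<times> laurent \<times> laurent" where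
  "elt x k y z \<equiv> (x, k, y, coset_rep W z)"

lemma carrier_cases:
  assumes "g \<in> carrier (hall_group W)"
  obtains x k y z where "g = elt x k y z"
  using assms by (auto simp: hall_group_def)

lemma elt_closed [simp]: "elt x k y z \<in> carrier (hall_group W)"
  by (simp add: hall_group_def)

lemma elt_mult [simp]:
  "elt x k y z \<otimes>\<^bsub>hall_group W\<^esub> elt x' k' y' z' =
   elt (x' + x * T k') (k + k') (T k * y' + y) (z + z' + x * y')"
proof -
  have "coset_rep W (coset_rep W z + coset_rep W z' + x * y') = coset_rep W (z + z' + x * y')"
    by (metis (no_types, lifting) add.assoc coset_rep_add)
  then show ?thesis by (simp add: hall_group_def)
qed

lemma one_eq: "\<one>\<^bsub>hall_group W\<^esub> = elt 0 0 0 0"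
  by (simp add: hall_group_def)

lemma group_hall_group: "group (hall_group W)"
proof (rule groupI)
  fix a b c
  assume a: "a \<in> carrier (hall_group W)" and b: "b \<in> carrier (hall_group W)"
    and c: "c \<in> carrier (hall_group W)"
  show "a \<otimes>\<^bsub>hall_group W\<^esub> b \<in> carrier (hall_group W)"
    by (rule carrier_cases[OF a], rule carrier_cases[OF b]) simp
  show "a \<otimes>\<^bsub>hall_group W\<^esub> b \<otimes>\<^bsub>hall_group W\<^esub> c = a \<otimes>\<^bsub>hall_group W\<^esub> (b \<otimes>\<^bsub>hall_group W\<^esub> c)"
    by (rule carrier_cases[OF a], rule carrier_cases[OF b], rule carrier_cases[OF c])
      (simp add: T_add algebra_simps)
next
  show "\<one>\<^bsub>hall_group W\<^esub> \<in> carrier (hall_group W)" by (simp add: one_eq)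
next
  fix a assume a: "a \<in> carrier (hall_group W)"
  show "\<one>\<^bsub>hall_group W\<^esub> \<otimes>\<^bsub>hall_group W\<^esub> a = a"
    by (rule carrier_cases[OF a]) (simp add: one_eq)
  show "\<exists>b\<in>carrier (hall_group W). b \<otimes>\<^bsub>hall_group W\<^esub> a = \<one>\<^bsub>hall_group W\<^esub>"
  proof (rule carrier_cases[OF a])
    fix x k y z assume "a = elt x k y z"
    \<comment> \<open>These are the entries of the inverse matrix.\<close>
    then have "elt (- (x * T (- k))) (- k) (- (T (- k) * y)) (x * T (- k) * y - z)
        \<otimes>\<^bsub>hall_group W\<^esub> a = \<one>\<^bsub>hall_group W\<^esub>"
      by (simp add: one_eq algebra_simps mult_single)
    then show ?thesis using elt_closed by blast
  qed
qed

sublocale hall: group "hall_group W"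
  by (rule group_hall_group)

lemma inv_elt: "inv\<^bsub>hall_group W\<^esub> (elt x k y z) =
    elt (- (x * T (- k))) (- k) (- (T (- k) * y)) (x * T (- k) * y - z)"
  by (rule hall.inv_equality) (simp_all add: one_eq algebra_simps mult_single)

lemma countable_carrier: "countable (carrier (hall_group W))"
proof -
  have "carrier (hall_group W) \<subseteq> UNIV \<times> UNIV \<times> UNIV \<times> UNIV" by simp
  then show ?thesis
    by (rule countable_subset) (intro countable_SIGMA countable_laurent countableI_type)
qed

lemma finitely_generated_hall_group: "finitely_generated_group (hall_group W)"
proof -
  \<comment> \<open>The diagonal entry t and the entries x = 1 and y = 1 suffice: conjugation by
    powers of t spreads the last two over the whole ring, and commutators supply z.\<close>
  let ?S = "{elt 1 0 0 0, elt 0 1 0 0, elt 0 0 1 0}"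
  define M where "M = generate (hall_group W) ?S"
  have S: "?S \<subseteq> carrier (hall_group W)" by simp
  have sub: "subgroup M (hall_group W)"
    unfolding M_def using S by (rule hall.generate_is_subgroup)
  note M_mult = subgroup.m_closed[OF sub] and M_inv = subgroup.m_inv_closed[OF sub]
  have gens: "elt 1 0 0 0 \<in> M" "elt 0 1 0 0 \<in> M" "elt 0 0 1 0 \<in> M"
    unfolding M_def by (auto intro: generate.incl)
  have t: "elt 0 k 0 0 \<in> M" for k
  proof (induction k rule: int_induct[where k = 0])
    case base
    then show ?case using subgroup.one_closed[OF sub] by (simp add: one_eq)
  next
    case (step1 i)
    then show ?case using M_mult[OF step1(2) gens(2)] by simp
  next
    case (step2 i)
    then show ?case using M_mult[OF step2(2) M_inv[OF gens(2)]] by (simp add: inv_elt)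
  qed
  have x: "elt x 0 0 0 \<in> M" for x
  proof (induction x rule: laurent_induct)
    case one
    then show ?case by (rule gens(1))
  next
    case (T f k)
    \<comment> \<open>Here t^k stands on the right of the conjugation because x is multiplied by the
      diagonal entry of the right factor; for y below the order is reversed.\<close>
    then show ?case using M_mult[OF M_mult[OF t[of "- k"] T] t[of k]] by (simp add: mult.commute)
  next
    case (diff f g)
    then show ?case using M_mult[OF diff(1) M_inv[OF diff(2)]] by (simp add: inv_elt)
  qed
  have y: "elt 0 0 y 0 \<in> M" for y
  proof (induction y rule: laurent_induct)
    case one
    then show ?case by (rule gens(3))
  next
    case (T f k)
    then show ?case using M_mult[OF M_mult[OF t[of k] T] t[of "- k"]] by simp
  next
    case (diff f g)
    then show ?case using M_mult[OF diff(1) M_inv[OF diff(2)]] by (simp add: inv_elt)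
  qed
  \<comment> \<open>The commutator of the elements with x = z and y = 1 has the single entry
    z.\<close>
  have z: "elt 0 0 0 z \<in> M" for z
    using M_mult[OF M_mult[OF x[of z] y[of 1]] M_inv[OF M_mult[OF y[of 1] x[of z]]]]
    by (simp add: inv_elt)
  \<comment> \<open>In this order of the factors neither a mixed term x y nor a power of t is
    produced.\<close>
  have "elt x k y z \<in> M" for x k y z
    using M_mult[OF M_mult[OF M_mult[OF z[of z] y[of y]] t[of k]] x[of x]] by simp
  then have "carrier (hall_group W) \<subseteq> M"
    using carrier_cases by (metis subsetI)
  then have "generate (hall_group W) ?S = carrier (hall_group W)"
    using subgroup.subset[OF sub] unfolding M_def by blast
  then show ?thesis
    unfolding finitely_generated_group_def using S
    by (intro conjI exI[of _ ?S] group_hall_group) simp_all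
qed

end

section \<open>Epimorphisms between the quotients\<close>

lemma Con_t_hall_group_subset:
  assumes "add_subgroup V" "add_subgroup W" and shift: "\<And>v. v \<in> V \<Longrightarrow> T j * v \<in> W"
  shows "Con_t (hall_group W) \<subseteq> Con_t (hall_group V)"
proof -
  interpret V: laurent_subgroup V using assms(1) by unfold_locales
  interpret W: laurent_subgroup W using assms(2) by unfold_locales
  \<comment> \<open>Conjugation by diag(t^j, 1, 1) multiplies x and z by t^j and fixes k and y. It
    descends to the quotients because t^j V lies in W.\<close>
  let ?h = "\<lambda>(x, k, y, z). (T j * x, k, y, coset_rep W (T j * z))"
  have h_elt: "?h (V.elt x k y z) = W.elt (T j * x) k y (T j * z)" for x k y z
  proof -
    have "T j * z - T j * coset_rep V z \<in> W"
      using shift[OF V.diff_coset_rep] by (simp add: right_diff_distrib)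
    then show ?thesis by (simp add: W.coset_rep_eq_iff[symmetric])
  qed
  have "?h \<in> hom (hall_group V) (hall_group W)"
  proof (rule homI)
    fix a assume "a \<in> carrier (hall_group V)"
    then show "?h a \<in> carrier (hall_group W)"
      by (rule V.carrier_cases) (simp only: h_elt W.elt_closed)
  next
    fix a b assume a: "a \<in> carrier (hall_group V)" and b: "b \<in> carrier (hall_group V)"
    show "?h (a \<otimes>\<^bsub>hall_group V\<^esub> b) = ?h a \<otimes>\<^bsub>hall_group W\<^esub> ?h b"
      by (rule V.carrier_cases[OF a], rule V.carrier_cases[OF b])
        (simp only: h_elt V.elt_mult W.elt_mult, simp add: algebra_simps)
  qed
  then interpret group_hom "hall_group V" "hall_group W" ?h
    by unfold_locales
  have kernel: "\<exists>z. k = V.elt 0 0 0 z" if k: "k \<in> kernel (hall_group V) (hall_group W) ?h" for k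
  proof -
    obtain x i y z where k_eq: "k = V.elt x i y z"
      using k by (auto simp: kernel_def elim: V.carrier_cases)
    have "?h k = W.elt 0 0 0 0" using k by (simp add: kernel_def W.one_eq)
    then have eq: "T j * x = 0" "i = 0" "y = 0"
      unfolding k_eq h_elt by auto
    \<comment> \<open>The monomial t^j is a unit, so only the entry z can survive in the
      kernel.\<close>
    have "x = T (- j) * (T j * x)" by simp
    also have "\<dots> = 0" using eq(1) by simp
    finally show ?thesis using k_eq eq by blast
  qed
  show ?thesis
  proof (rule Con_t_subset)
    have "b \<in> ?h ` carrier (hall_group V)" if b: "b \<in> carrier (hall_group W)" for b
    proof -
      obtain x k y z where "b = W.elt x k y z" by (rule W.carrier_cases[OF b])
      then have "b = ?h (V.elt (T (- j) * x) k y (T (- j) * z))"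
        unfolding h_elt by simp
      then show ?thesis using V.elt_closed by (rule image_eqI)
    qed
    then show "?h ` carrier (hall_group V) = carrier (hall_group W)"
      by (auto simp del: split_paired_All)
  next
    fix k g assume k: "k \<in> kernel (hall_group V) (hall_group W) ?h" and g: "g \<in> carrier (hall_group V)"
    obtain z where z: "k = V.elt 0 0 0 z" using kernel[OF k] by blast
    show "k \<otimes>\<^bsub>hall_group V\<^esub> g = g \<otimes>\<^bsub>hall_group V\<^esub> k"
      by (rule V.carrier_cases[OF g]) (simp add: z add.commute)
  next
    fix k assume "k \<in> kernel (hall_group V) (hall_group W) ?h"
    then obtain z where z: "k = V.elt 0 0 0 z" using kernel by blast
    \<comment> \<open>A central element with entry z is the commutator of the elements with x = z
      and y = 1.\<close>
    have "k \<otimes>\<^bsub>hall_group V\<^esub> (V.elt 0 0 1 0 \<otimes>\<^bsub>hall_group V\<^esub> V.elt z 0 0 0) =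
        V.elt z 0 0 0 \<otimes>\<^bsub>hall_group V\<^esub> V.elt 0 0 1 0"
      by (simp add: z)
    then show "\<exists>a\<in>carrier (hall_group V). \<exists>b\<in>carrier (hall_group V).
        k \<otimes>\<^bsub>hall_group V\<^esub> (b \<otimes>\<^bsub>hall_group V\<^esub> a) = a \<otimes>\<^bsub>hall_group V\<^esub> b"
      using V.elt_closed by blast
  qed
qed

section \<open>The two subgroups and the elements of order two\<close>

definition positive_part :: "laurent set" where
  "positive_part = {f. \<forall>i\<le>0. Poly_Mapping.lookup f i = 0}"

text \<open>This is W' = 2 Z + t Z[t], and \<open>positive_part\<close> is W = t Z[t].\<close>

definition even_part :: "laurent set" where
  "even_part = {f. (\<forall>i<0. Poly_Mapping.lookup f i = 0) \<and> even (Poly_Mapping.lookup f 0)}"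

lemma add_subgroup_positive_part: "add_subgroup positive_part"
  by (simp add: add_subgroup_def positive_part_def lookup_minus)

lemma add_subgroup_even_part: "add_subgroup even_part"
  by (simp add: add_subgroup_def even_part_def lookup_minus)

interpretation positive: laurent_subgroup positive_part
  by unfold_locales (rule add_subgroup_positive_part)

interpretation even: laurent_subgroup even_part
  by unfold_locales (rule add_subgroup_even_part)

lemma Con_t_hall_group_eq: "Con_t (hall_group positive_part) = Con_t (hall_group even_part)"
proof
  \<comment> \<open>Multiplication by t carries W' into W, hence the shift j = 1; in the other
    direction W is already contained in W', so j = 0.\<close>
  show "Con_t (hall_group positive_part) \<subseteq> Con_t (hall_group even_part)"
    by (rule Con_t_hall_group_subset[OF add_subgroup_even_part add_subgroup_positive_part, where j = 1])
      (auto simp: positive_part_def even_part_def lookup_T_mult)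
  show "Con_t (hall_group even_part) \<subseteq> Con_t (hall_group positive_part)"
    by (rule Con_t_hall_group_subset[OF add_subgroup_positive_part add_subgroup_even_part, where j = 0])
      (auto simp: positive_part_def even_part_def)
qed

lemma laurent_double_eq_0: "f + f = 0 \<longleftrightarrow> f = (0 :: laurent)"
proof
  assume "f + f = 0"
  then have "Poly_Mapping.lookup f i + Poly_Mapping.lookup f i = 0" for i
    by (metis lookup_add lookup_zero)
  then show "f = 0" by (intro poly_mapping_eqI) simp
qed simp

text \<open>The square has diagonal exponent 2 k, so k = 0; then x and y vanish because the ring has
  no 2-torsion. What remains is 2 z in W, and this forces z in W because membership in W only
  requires certain integer coefficients to vanish.\<close>

lemma positive_no_involution:
  assumes "g \<in> carrier (hall_group positive_part)"
    and "g \<otimes>\<^bsub>hall_group positive_part\<^esub> g = \<one>\<^bsub>hall_group positive_part\<^esub>"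
  shows "g = \<one>\<^bsub>hall_group positive_part\<^esub>"
proof -
  obtain x k y z where g: "g = positive.elt x k y z"
    using assms(1) by (rule positive.carrier_cases)
  have eq: "x + x * T k = 0" "k + k = 0" "T k * y + y = 0"
    "coset_rep positive_part (z + z + x * y) = coset_rep positive_part 0"
    using assms(2) unfolding g positive.elt_mult positive.one_eq by auto
  then have xyk: "k = 0" "x = 0" "y = 0"
    by (auto simp: laurent_double_eq_0)
  then have "z + z \<in> positive_part"
    using eq(4) by (simp add: positive.coset_rep_eq_iff)
  then have "Poly_Mapping.lookup z i + Poly_Mapping.lookup z i = 0" if "i \<le> 0" for i
    using that unfolding positive_part_def mem_Collect_eq lookup_add by blast
  then have "z \<in> positive_part"
    by (simp add: positive_part_def)
  then show ?thesis
    unfolding g positive.one_eq xyk by (simp add: positive.coset_rep_eq_iff)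
qed

lemma even_involution:
  obtains g where "g \<in> carrier (hall_group even_part)"
    and "g \<otimes>\<^bsub>hall_group even_part\<^esub> g = \<one>\<^bsub>hall_group even_part\<^esub>"
    and "g \<noteq> \<one>\<^bsub>hall_group even_part\<^esub>"
proof
  \<comment> \<open>The constant 1 has order 2 modulo \<open>even_part\<close>: its coefficient at
    exponent 0 is odd, whereas that of 1 + 1 is even.\<close>
  let ?g = "even.elt 0 0 0 1"
  show "?g \<in> carrier (hall_group even_part)" by simp
  show "?g \<otimes>\<^bsub>hall_group even_part\<^esub> ?g = \<one>\<^bsub>hall_group even_part\<^esub>"
  proof -
    have "(1 + 1 :: laurent) \<in> even_part"
      unfolding even_part_def mem_Collect_eq lookup_add by (simp add: lookup_one when_def)
    then have "coset_rep even_part (1 + 1) = coset_rep even_part 0"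
      by (simp only: even.coset_rep_eq_iff diff_zero)
    then show ?thesis
      unfolding even.elt_mult even.one_eq by simp
  qed
  show "?g \<noteq> \<one>\<^bsub>hall_group even_part\<^esub>"
  proof -
    have "(1 :: laurent) \<notin> even_part"
      by (simp add: even_part_def lookup_one)
    then have "coset_rep even_part 1 \<noteq> coset_rep even_part 0"
      by (simp only: even.coset_rep_eq_iff diff_zero not_False_eq_True)
    then show ?thesis unfolding even.one_eq by simp
  qed
qed

lemma hall_groups_not_iso: "\<not> hall_group even_part \<cong> hall_group positive_part"
proof
  assume "hall_group even_part \<cong> hall_group positive_part"
  then obtain h where h: "h \<in> hom (hall_group even_part) (hall_group positive_part)"
    "inj_on h (carrier (hall_group even_part))"
    by (auto simp: is_iso_def iso_def bij_betw_def)
  interpret group_hom "hall_group even_part" "hall_group positive_part" h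
    by unfold_locales (rule h(1))
  obtain g where g: "g \<in> carrier (hall_group even_part)"
    "g \<otimes>\<^bsub>hall_group even_part\<^esub> g = \<one>\<^bsub>hall_group even_part\<^esub>" "g \<noteq> \<one>\<^bsub>hall_group even_part\<^esub>"
    by (rule even_involution)
  have "h g \<otimes>\<^bsub>hall_group positive_part\<^esub> h g = \<one>\<^bsub>hall_group positive_part\<^esub>"
    using g(1,2) by (metis hom_mult hom_one)
  then have "h g = h \<one>\<^bsub>hall_group even_part\<^esub>"
    using positive_no_involution[OF hom_closed[OF g(1)]] by simp
  then show False
    using g(1,3) inj_onD[OF h(2)] even.hall.one_closed by blast
qed

theorem theorem4p3:
  shows "\<exists>(G :: nat monoid) (H :: nat monoid).
           finitely_generated_group G \<and> finitely_generated_group H \<and>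
           \<not> G \<cong> H \<and> Con_t G = Con_t H"
proof -
  \<comment> \<open>Both quotients are countable, so they have isomorphic copies on sets of natural
    numbers; finite generation, non-isomorphism and equality of the configuration sets pass to the
    copies.\<close>
  obtain G :: "nat monoid" where G: "group G" "hall_group even_part \<cong> G"
    using countable_group_iso_nat[OF even.group_hall_group even.countable_carrier] .
  obtain H :: "nat monoid" where H: "group H" "hall_group positive_part \<cong> H"
    using countable_group_iso_nat[OF positive.group_hall_group positive.countable_carrier] .
  have "finitely_generated_group G"
    using even.finitely_generated_hall_group G by (rule finitely_generated_group_iso)
  moreover have "finitely_generated_group H"
    using positive.finitely_generated_hall_group H by (rule finitely_generated_group_iso)
  moreover have "\<not> G \<cong> H"
  proof
    assume "G \<cong> H"
    then have "hall_group even_part \<cong> H" using G(2) iso_trans by blast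
    then have "hall_group even_part \<cong> hall_group positive_part"
      using group.iso_sym[OF positive.group_hall_group H(2)] iso_trans by blast
    then show False using hall_groups_not_iso by blast
  qed
  moreover have "Con_t G = Con_t H"
    using Con_t_iso[OF even.group_hall_group G] Con_t_iso[OF positive.group_hall_group H]
      Con_t_hall_group_eq by simp
  ultimately show ?thesis by blast
qed

end
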